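(* Let $k\ge 1$ and let $\pi:\{1,\dots,k\}\to\{1,\dots,k\}$ be a permutation. Let $P$ be the 2-tuple matching determined by $\pi$, i.e. the ordered graph with vertex set $\{v_1<\dots<v_{3k}\}$ and edge set $\{v_jv_{k+i+2(\pi(j)-1)} : i\in\{1,2\},\ j\in\{1,\dots,k\}\}$. Then $ex_<(n,P)=O(n)$, where the implied constant depends only on $P$.
   Context: An ordered graph is a graph whose vertex set carries a fixed linear order. An ordered graph $G$ contains an ordered graph $P$ if there is an injective, order-preserving map $V(P)\to V(G)$ sending edges of $P$ to edges of $G$; otherwise $G$ avoids $P$. For an ordered graph $P$ with at least one edge, $ex_<(n,P)$ is the maximum number of edges of an ordered graph on $n$ vertices that avoids $P$. *)

theory Defs
  imports "HOL-Library.Landau_Symbols"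
begin

text \<open>The linear order of the vertices is the one of the ambient type.\<close>

type_synonym 'a ograph = "'a set \<times> 'a set set"

abbreviation verts :: "'a ograph \<Rightarrow> 'a set" where
  "verts \<equiv> fst"

abbreviation edges :: "'a ograph \<Rightarrow> 'a set set" where
  "edges \<equiv> snd"

definition ordered_graph :: "'a::linorder ograph \<Rightarrow> bool" where
  "ordered_graph G \<longleftrightarrow>
     finite (verts G) \<and> (\<forall>e\<in>edges G. e \<subseteq> verts G \<and> card e = 2)"

definition og_contains :: "'a::linorder ograph \<Rightarrow> 'b::linorder ograph \<Rightarrow> bool" where
  "og_contains G P \<longleftrightarrow>
     (\<exists>f. f ` verts P \<subseteq> verts G \<and> inj_on f (verts P) \<and> mono_on (verts P) f \<and>
          (\<forall>e\<in>edges P. f ` e \<in> edges G))"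

abbreviation og_avoids :: "'a::linorder ograph \<Rightarrow> 'b::linorder ograph \<Rightarrow> bool" where
  "og_avoids G P \<equiv> \<not> og_contains G P"

text \<open>Every ordered graph on \<open>n\<close> vertices is order-isomorphic to one whose vertices are natural
  numbers, so it suffices to let the host graphs range over these. The set under \<^const>\<open>Max\<close> is
  finite, and it is nonempty if \<open>P\<close> has an edge; see \<open>ex_ord_welldefined\<close> below.\<close>

definition ex_ord :: "nat \<Rightarrow> 'b::linorder ograph \<Rightarrow> nat" where
  "ex_ord n P =
     Max {card (edges G) |G :: nat ograph.
            ordered_graph G \<and> card (verts G) = n \<and> og_avoids G P}"

definition two_tuple_matching :: "nat \<Rightarrow> (nat \<Rightarrow> nat) \<Rightarrow> nat ograph" where
  "two_tuple_matching k \<pi> =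
     ({1..3 * k}, {{j, k + i + 2 * (\<pi> j - 1)} |i j. i \<in> {1, 2} \<and> j \<in> {1..k}})"

lemma ex_ord_welldefined:
  fixes P :: "'b::linorder ograph"
  assumes "edges P \<noteq> {}"
  defines "S \<equiv> \<lambda>n. {card (edges G) |G :: nat ograph.
                      ordered_graph G \<and> card (verts G) = n \<and> og_avoids G P}"
  shows "finite (S n)" "S n \<noteq> {}"
proof -
  have "S n \<subseteq> {..2 ^ n}"
  proof
    fix m assume "m \<in> S n"
    then obtain G :: "nat ograph" where G: "ordered_graph G" "card (verts G) = n"
      and m: "m = card (edges G)"
      by (auto simp: S_def)
    have "edges G \<subseteq> Pow (verts G)" and fin: "finite (verts G)"
      using G by (auto simp: ordered_graph_def)
    then have "m \<le> card (Pow (verts G))"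
      unfolding m by (intro card_mono) auto
    then show "m \<in> {..2 ^ n}"
      using G(2) fin by (simp add: card_Pow)
  qed
  then show "finite (S n)"
    by (rule finite_subset) simp
  let ?G = "({..<n}, {}) :: nat ograph"
  have "ordered_graph ?G" "card (verts ?G) = n" "og_avoids ?G P"
    using assms(1) by (auto simp: ordered_graph_def og_contains_def)
  then have "card (edges ?G) \<in> S n"
    unfolding S_def by blast
  then show "S n \<noteq> {}"
    by blast
qed

lemma ordered_graph_two_tuple_matching:
  assumes "bij_betw \<pi> {1..k} {1..k}"
  shows "ordered_graph (two_tuple_matching k \<pi>)"
proof -
  have "1 \<le> \<pi> j \<and> \<pi> j \<le> k" if "j \<in> {1..k}" for j
    using bij_betwE[OF assms] that by auto
  then show ?thesis
    by (fastforce simp: ordered_graph_def two_tuple_matching_def card_2_iff)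
qed

lemma edges_two_tuple_matching_nonempty:
  assumes "k \<ge> 1"
  shows "edges (two_tuple_matching k \<pi>) \<noteq> {}"
  using assms by (force simp: two_tuple_matching_def)

end

theory Submission
  imports Defs
begin

text \<open>
  The proof adapts the Marcus--Tardos argument. Read an ordered graph as a 0-1 matrix with all
  entries above the diagonal. Extending the pattern by one more row (the last one) whose two entries
  occupy the first two columns forces, in any occurrence, all rows to precede all columns; hence it
  suffices to bound the number of entries of a matrix that avoids a double permutation pattern.

  Cut the matrix into \<open>s \<times> s\<close> blocks. In each row of blocks, greedily merge consecutive blocks into
  chunks, closing a chunk as soon as some row has two entries in it. Record the first block of every
  chunk: between two recorded blocks of the same row of blocks there are two entries of a common
  row, so the contracted matrix avoids the same pattern. Chunks meeting at least \<open>k\<close> rows (tall) or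
  with more than \<open>2k\<close> entries in a row (wide) are linear in number by pigeonhole, and all others
  have at most \<open>2k\<^sup>2\<close> entries, which gives a recursion with a linear solution.
\<close>

section \<open>Double permutation patterns in 0-1 matrices, and counting tools\<close>

text \<open>A matrix is given by the set of positions of its ones. Pattern rows are numbered from 0,
  and only the order of the values of \<open>\<sigma>\<close> enters, so a further row can be given
  the value 0 below the others without renumbering.\<close>

definition contains_double :: "nat \<Rightarrow> (nat \<Rightarrow> nat) \<Rightarrow> (nat \<times> nat) set \<Rightarrow> bool" where
  "contains_double k \<sigma> A \<longleftrightarrow>
     (\<exists>r a b. (\<forall>j<k. (r j, a j) \<in> A \<and> (r j, b j) \<in> A \<and> a j < b j) \<and>
              (\<forall>j j'. j < j' \<longrightarrow> j' < k \<longrightarrow> r j < r j') \<and>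
              (\<forall>j<k. \<forall>j'<k. \<sigma> j < \<sigma> j' \<longrightarrow> b j < a j'))"

lemma contains_doubleE:
  assumes "contains_double k \<sigma> A"
  obtains r a b where "\<And>j. j < k \<Longrightarrow> (r j, a j) \<in> A \<and> (r j, b j) \<in> A \<and> a j < b j"
    "\<And>j j'. j < j' \<Longrightarrow> j' < k \<Longrightarrow> r j < r j'"
    "\<And>j j'. j < k \<Longrightarrow> j' < k \<Longrightarrow> \<sigma> j < \<sigma> j' \<Longrightarrow> b j < a j'"
proof -
  obtain r a b where *: "(\<forall>j<k. (r j, a j) \<in> A \<and> (r j, b j) \<in> A \<and> a j < b j) \<and>
      (\<forall>j j'. j < j' \<longrightarrow> j' < k \<longrightarrow> r j < r j') \<and>
      (\<forall>j<k. \<forall>j'<k. \<sigma> j < \<sigma> j' \<longrightarrow> b j < a j')"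
    using assms unfolding contains_double_def by (elim exE)
  show thesis
    by (rule that[of r a b]) (use * in auto)
qed

lemma card_le_fibres:
  assumes "finite X" "finite Y" "f ` X \<subseteq> Y"
    and "\<And>y. y \<in> Y \<Longrightarrow> card {x\<in>X. f x = y} \<le> m"
  shows "card X \<le> card Y * m"
proof -
  have "X = (\<Union>y\<in>Y. {x\<in>X. f x = y})"
    using assms(3) by auto
  then have "card X \<le> (\<Sum>y\<in>Y. card {x\<in>X. f x = y})"
    using card_UN_le[OF assms(2), of "\<lambda>y. {x\<in>X. f x = y}"] by simp
  also have "\<dots> \<le> card Y * m"
    using sum_bounded_above[of Y "\<lambda>y. card {x\<in>X. f x = y}" m] assms(4) by simp
  finally show ?thesis .
qed

lemma increasing_enumeration:
  fixes S :: "nat set"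
  assumes "m \<le> card S" "finite S"
  obtains e where "\<And>i. i < m \<Longrightarrow> e i \<in> S" "\<And>i j. i < j \<Longrightarrow> j < m \<Longrightarrow> e i < e j"
proof
  show "sorted_list_of_set S ! i \<in> S" if "i < m" for i
    using that assms nth_mem[of i "sorted_list_of_set S"] by simp
  show "sorted_list_of_set S ! i < sorted_list_of_set S ! j" if "i < j" "j < m" for i j
    using that assms strict_sorted_list_of_set[of S] by (simp add: sorted_wrt_iff_nth_less)
qed

section \<open>Greedy chunks and the contracted matrix\<close>

text \<open>The value names the chunk containing block \<open>t\<close> of block row
  \<open>q\<close> by its first block. The chunk is closed after block \<open>t\<close>, so that
  \<open>Suc t\<close> opens a new one, once the blocks from its start up to \<open>t\<close> hold
  two entries of one row.\<close>

primrec chunk_start :: "nat \<Rightarrow> (nat \<times> nat) set \<Rightarrow> nat \<Rightarrow> nat \<Rightarrow> nat" where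
  "chunk_start s A q 0 = 0"
| "chunk_start s A q (Suc t) =
     (if \<exists>r c c'. (r, c) \<in> A \<and> (r, c') \<in> A \<and> r div s = q \<and> c < c' \<and>
                  chunk_start s A q t \<le> c div s \<and> c' div s \<le> t
      then Suc t else chunk_start s A q t)"

lemma chunk_start_le: "chunk_start s A q t \<le> t"
  by (induction t) (auto simp: le_SucI)

lemma chunk_start_mono: "t \<le> t' \<Longrightarrow> chunk_start s A q t \<le> chunk_start s A q t'"
proof (rule lift_Suc_mono_le[of "chunk_start s A q"])
  show "chunk_start s A q n \<le> chunk_start s A q (Suc n)" for n
    using chunk_start_le[of s A q n] by auto
qed

text \<open>Hence the values are exactly the fixed points, that is, the blocks that open a
  chunk.\<close>

lemma chunk_start_idem: "chunk_start s A q (chunk_start s A q t) = chunk_start s A q t"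
proof (induction t)
  case (Suc t)
  then show ?case
    by (cases "chunk_start s A q (Suc t) = Suc t") (simp, simp split: if_splits)
qed simp

text \<open>The later start was opened because the chunk just before it already held two entries of
  one row, and that chunk does not begin before the earlier start.\<close>

lemma pair_between_chunk_starts:
  assumes "chunk_start s A q t < chunk_start s A q t'"
  obtains r c c' where "(r, c) \<in> A" "(r, c') \<in> A" "r div s = q" "c < c'"
    "chunk_start s A q t \<le> c div s" "c' div s < chunk_start s A q t'"
proof -
  define v where "v = chunk_start s A q t'"
  obtain w where w: "v = Suc w"
    using assms unfolding v_def by (cases "chunk_start s A q t'") auto
  \<comment> \<open>A fixed point at \<open>Suc w\<close> must come from the first branch of the
    recursion, since the other branch yields a value of at most \<open>w\<close>.\<close>
  have "chunk_start s A q (Suc w) = Suc w"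
    using chunk_start_idem[of s A q t'] w v_def by simp
  then obtain r c c' where rc: "(r, c) \<in> A" "(r, c') \<in> A" "r div s = q" "c < c'"
    "chunk_start s A q w \<le> c div s" "c' div s \<le> w"
    using chunk_start_le[of s A q w] by (auto split: if_splits)
  have "chunk_start s A q t \<le> chunk_start s A q w"
    using chunk_start_mono[of "chunk_start s A q t" w s A q] assms w v_def
    by (simp add: chunk_start_idem)
  with rc w show thesis
    using that[of r c c'] by (simp add: v_def)
qed

text \<open>The columns of the contracted matrix are still block indices, not chunk numbers. This
  keeps different block rows comparable although their chunks differ.\<close>

definition contract :: "nat \<Rightarrow> (nat \<times> nat) set \<Rightarrow> nat \<times> nat \<Rightarrow> nat \<times> nat" where
  "contract s A = (\<lambda>(r, c). (r div s, chunk_start s A (r div s) (c div s)))"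

lemma contract_Pair:
  "contract s A (r, c) = (r div s, chunk_start s A (r div s) (c div s))"
  by (simp add: contract_def)

text \<open>Each pair of contracted entries is replaced by two original entries of one row, lying in
  blocks from \<open>a j\<close> up to but excluding \<open>b j\<close>. These half-open ranges are
  ordered as the pairs are, so the pattern survives.\<close>

lemma contains_double_contract:
  assumes "contains_double k \<sigma> (contract s A ` A)"
  shows "contains_double k \<sigma> A"
proof -
  obtain R a b where
    mem: "\<And>j. j < k \<Longrightarrow> (R j, a j) \<in> contract s A ` A \<and> (R j, b j) \<in> contract s A ` A \<and> a j < b j"
    and R: "\<And>j j'. j < j' \<Longrightarrow> j' < k \<Longrightarrow> R j < R j'"
    and ba: "\<And>j j'. j < k \<Longrightarrow> j' < k \<Longrightarrow> \<sigma> j < \<sigma> j' \<Longrightarrow> b j < a j'"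
    using contains_doubleE[OF assms] by metis
  have "\<exists>r c c'. (r, c) \<in> A \<and> (r, c') \<in> A \<and> r div s = R j \<and> c < c' \<and>
          a j \<le> c div s \<and> c' div s < b j" if j: "j < k" for j
  proof -
    obtain t t' where "a j = chunk_start s A (R j) t" "b j = chunk_start s A (R j) t'"
      using mem[OF j] by (auto simp: contract_def)
    then show ?thesis
      using mem[OF j] pair_between_chunk_starts[of s A "R j" t t'] by metis
  qed
  then obtain r c c' where
    rc: "\<And>j. j < k \<Longrightarrow> (r j, c j) \<in> A \<and> (r j, c' j) \<in> A \<and> r j div s = R j \<and> c j < c' j \<and>
          a j \<le> c j div s \<and> c' j div s < b j"
    by metis
  have "r j < r j'" if "j < j'" "j' < k" for j j'
    using R[OF that] rc[of j] rc[of j'] that div_le_mono[of "r j'" "r j" s]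
    by (metis leD le_less_linear less_trans)
  moreover have "c' j < c j'" if "j < k" "j' < k" "\<sigma> j < \<sigma> j'" for j j'
  proof (rule ccontr)
    assume "\<not> c' j < c j'"
    then have "c j' div s \<le> c' j div s"
      by (simp add: div_le_mono)
    then show False
      using ba[OF that] rc[OF that(1)] rc[OF that(2)] by linarith
  qed
  ultimately show ?thesis
    unfolding contains_double_def using rc by blast
qed

section \<open>Sizes of chunks, and the number of tall and wide ones\<close>

definition chunk :: "nat \<Rightarrow> (nat \<times> nat) set \<Rightarrow> nat \<times> nat \<Rightarrow> (nat \<times> nat) set" where
  "chunk s A b = {x\<in>A. contract s A x = b}"

lemma in_block_iff:
  fixes s x t :: nat
  shows "s > 0 \<Longrightarrow> x \<in> {t * s..<t * s + s} \<longleftrightarrow> x div s = t"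
  by (metis add.commute atLeastLessThan_iff div_nat_eqI dividend_less_times_div
      mult.commute mult_Suc times_div_less_eq_dividend)

text \<open>In a row, all but at most one of the entries of a chunk lie in one block, since the
  chunk would have been closed earlier otherwise.\<close>

lemma chunk_row_last_block:
  assumes "finite A" "s > 0"
  obtains t where
    "card {c. (r, c) \<in> chunk s A b} \<le> Suc (card ({c. (r, c) \<in> chunk s A b} \<inter> {t * s..<t * s + s}))"
proof -
  define C where "C = {c. (r, c) \<in> chunk s A b}"
  have "C \<subseteq> snd ` A"
    unfolding C_def chunk_def by force
  then have fin: "finite C"
    using assms(1) finite_surj by blast
  \<comment> \<open>The last block in which the row meets the chunk. If \<open>C\<close> is empty
    the value is arbitrary and the bound is trivial.\<close>
  define t where "t = Max C div s"
  have st: "chunk_start s A (r div s) (c div s) = snd b" if "c \<in> C" for c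
    using that by (auto simp: C_def chunk_def contract_def)
  \<comment> \<open>If \<open>c2\<close> lay before block \<open>t\<close>, the pair
    \<open>c1\<close>, \<open>c2\<close> would close the chunk after the block of \<open>c2\<close>,
    and \<open>Max C\<close> would belong to a later chunk.\<close>
  have no: False if c: "c1 \<in> C" "c2 \<in> C" "c1 < c2" "c2 div s \<noteq> t" for c1 c2
  proof -
    have "Max C \<in> C" "c2 \<le> Max C"
      using fin c by (auto intro: Max_in)
    then have "c2 div s \<le> t"
      unfolding t_def by (simp add: div_le_mono)
    then have "Suc (c2 div s) \<le> t"
      using c(4) by simp
    then have "chunk_start s A (r div s) (Suc (c2 div s)) \<le> snd b"
      using chunk_start_mono[of "Suc (c2 div s)" t s A "r div s"] st[OF \<open>Max C \<in> C\<close>]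
      unfolding t_def by simp
    moreover have "\<exists>r' c c'. (r', c) \<in> A \<and> (r', c') \<in> A \<and> r' div s = r div s \<and> c < c' \<and>
        chunk_start s A (r div s) (c2 div s) \<le> c div s \<and> c' div s \<le> c2 div s"
    proof (intro exI conjI)
      show "(r, c1) \<in> A" "(r, c2) \<in> A"
        using c by (auto simp: C_def chunk_def)
      show "chunk_start s A (r div s) (c2 div s) \<le> c1 div s"
        using st[OF c(1)] st[OF c(2)] chunk_start_le[of s A "r div s" "c1 div s"] by simp
    qed (use c in auto)
    then have "chunk_start s A (r div s) (Suc (c2 div s)) = Suc (c2 div s)"
      by simp
    ultimately show False
      using st[OF c(2)] chunk_start_le[of s A "r div s" "c2 div s"] by simp
  qed
  have "card (C - {t * s..<t * s + s}) \<le> 1"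
  proof -
    have "x = y" if "x \<in> C - {t * s..<t * s + s}" "y \<in> C - {t * s..<t * s + s}" for x y
      using that no[of x y] no[of y x] in_block_iff[OF assms(2)] by (metis DiffE nat_neq_iff)
    then show ?thesis
      using fin by (intro card_le_Suc0_iff_eq[THEN iffD2, folded One_nat_def]) auto
  qed
  moreover have "card C = card (C \<inter> {t * s..<t * s + s}) + card (C - {t * s..<t * s + s})"
    using fin by (metis Int_Diff_Un Int_Diff_disjoint card_Un_disjoint finite_Diff finite_Int)
  ultimately show thesis
    using that[of t] by (simp add: C_def)
qed

lemma chunk_rows_subset:
  assumes "s > 0"
  shows "fst ` chunk s A b \<subseteq> {fst b * s..<fst b * s + s}"
  using in_block_iff[OF assms] by (fastforce simp: chunk_def contract_def)

lemma finite_chunk: "finite A \<Longrightarrow> finite (chunk s A b)"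
  by (simp add: chunk_def)

lemma card_chunk_le:
  assumes "finite A" "\<And>r. card {c. (r, c) \<in> chunk s A b} \<le> m"
  shows "card (chunk s A b) \<le> card (fst ` chunk s A b) * m"
proof (rule card_le_fibres[where f = fst])
  fix r
  have "{x \<in> chunk s A b. fst x = r} = Pair r ` {c. (r, c) \<in> chunk s A b}"
    by auto
  then show "card {x \<in> chunk s A b. fst x = r} \<le> m"
    using assms(2)[of r] by (simp add: card_image inj_on_def)
qed (use assms finite_chunk in auto)

text \<open>Pigeonhole over labels made of a block and a subset of its \<open>s\<close> indices, of
  which there are \<open>N * 2 ^ s\<close>. It serves row blocks for tall chunks and column blocks
  for wide ones.\<close>

lemma card_blocks_le:
  fixes s N m :: nat
  assumes "finite X" "s > 0"
    and "\<And>x. x \<in> X \<Longrightarrow> f x \<in> (SIGMA q:{..<N}. Pow {q * s..<q * s + s})"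
    and "\<And>q S. card {x\<in>X. f x = (q, S)} \<le> m"
  shows "card X \<le> N * 2 ^ s * m"
proof -
  have "card (SIGMA q:{..<N}. Pow {q * s..<q * s + s}) = N * 2 ^ s"
    by (simp add: card_SigmaI card_Pow)
  then show ?thesis
    using card_le_fibres[of X "SIGMA q:{..<N}. Pow {q * s..<q * s + s}" f m] assms by fastforce
qed

text \<open>\<open>2k\<close> chunks of one row of blocks that meet the same \<open>k\<close> rows contain every pattern.\<close>

lemma card_tall_chunks:
  assumes A: "finite A" "contract s A ` A \<subseteq> {..<N} \<times> {..<N}" "s > 0"
    and avoid: "\<not> contains_double k \<sigma> A" and \<sigma>: "\<And>j. j < k \<Longrightarrow> \<sigma> j < k"
  shows "card {b \<in> contract s A ` A. k \<le> card (fst ` chunk s A b)} \<le> N * 2 ^ s * (2 * k)"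
proof (rule card_blocks_le[where f = "\<lambda>b. (fst b, fst ` chunk s A b)"])
  let ?T = "{b \<in> contract s A ` A. k \<le> card (fst ` chunk s A b)}"
  fix q S
  define X where "X = {b \<in> ?T. (fst b, fst ` chunk s A b) = (q, S)}"
  have finX: "finite X"
    using A(1) by (simp add: X_def)
  show "card {b \<in> ?T. (fst b, fst ` chunk s A b) = (q, S)} \<le> 2 * k"
  proof (rule ccontr)
    assume "\<not> ?thesis"
    then have big: "2 * k < card X"
      by (simp add: X_def)
    then obtain b0 where "b0 \<in> X"
      by (metis card.empty equals0I not_less_zero)
    then have "k \<le> card S" "finite S"
      using A(1) by (auto simp: X_def finite_chunk)
    then obtain r where r: "\<And>i. i < k \<Longrightarrow> r i \<in> S" "\<And>i j. i < j \<Longrightarrow> j < k \<Longrightarrow> r i < r j"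
      using increasing_enumeration by blast
    have "inj_on snd X"
      by (auto simp: inj_on_def X_def)
    then have "2 * k \<le> card (snd ` X)"
      using big by (simp add: card_image)
    then obtain u where u: "\<And>i. i < 2 * k \<Longrightarrow> u i \<in> snd ` X"
      "\<And>i j. i < j \<Longrightarrow> j < 2 * k \<Longrightarrow> u i < u j"
      using increasing_enumeration[of "2 * k" "snd ` X"] finX by blast
    have "\<exists>c. (r j, c) \<in> chunk s A (q, u i)" if "j < k" "i < 2 * k" for i j
    proof -
      have "(q, u i) \<in> X"
        using u(1)[OF that(2)] by (auto simp: X_def)
      then have "r j \<in> fst ` chunk s A (q, u i)"
        using r(1)[OF that(1)] by (simp add: X_def)
      then show ?thesis
        by force
    qed
    then obtain g where g: "\<And>j i. j < k \<Longrightarrow> i < 2 * k \<Longrightarrow> (r j, g j i) \<in> chunk s A (q, u i)"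
      by metis
    have gA: "(r j, g j i) \<in> A" if "j < k" "i < 2 * k" for i j
      using g[OF that] by (simp add: chunk_def)
    \<comment> \<open>Entries of different chunks in one block row are ordered by the chunks alone,
      whichever rows they are in.\<close>
    have less: "g j i < g j' i'" if "j < k" "j' < k" "i < i'" "i' < 2 * k" for i i' j j'
    proof (rule ccontr)
      assume "\<not> ?thesis"
      then have "g j' i' div s \<le> g j i div s"
        by (simp add: div_le_mono)
      then have "chunk_start s A q (g j' i' div s) \<le> chunk_start s A q (g j i div s)"
        by (rule chunk_start_mono)
      then have "u i' \<le> u i"
        using g[of j i] g[of j' i'] that by (auto simp: chunk_def contract_def)
      then show False
        using u(2) that by fastforce
    qed
    \<comment> \<open>Pattern row \<open>j\<close> takes one entry from each of the chunks numbered
      \<open>2 * \<sigma> j\<close> and \<open>2 * \<sigma> j + 1\<close>.\<close>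
    have "contains_double k \<sigma> A"
      unfolding contains_double_def
    proof (intro exI conjI allI impI)
      fix j assume j: "j < k"
      show "(r j, g j (2 * \<sigma> j)) \<in> A" "(r j, g j (2 * \<sigma> j + 1)) \<in> A"
        "g j (2 * \<sigma> j) < g j (2 * \<sigma> j + 1)"
        using j \<sigma>[OF j] by (auto intro: gA less)
      fix j' assume j': "j' < k" "\<sigma> j < \<sigma> j'"
      show "g j (2 * \<sigma> j + 1) < g j' (2 * \<sigma> j')"
        using j j' \<sigma>[OF j'(1)] by (intro less) auto
    qed (use r in auto)
    then show False
      using avoid by simp
  qed
next
  fix b assume "b \<in> {b \<in> contract s A ` A. k \<le> card (fst ` chunk s A b)}"
  then have "fst b < N"
    using A(2) by (auto dest!: subsetD)
  then show "(fst b, fst ` chunk s A b) \<in> (SIGMA q:{..<N}. Pow {q * s..<q * s + s})"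
    using chunk_rows_subset[OF A(3), of A b] by simp
qed (use A in auto)

text \<open>\<open>k\<close> chunks with entries, each in a single row, in the same \<open>2k\<close> columns of one column of
  blocks contain every pattern.\<close>

lemma card_wide_chunks:
  assumes A: "finite A" "A \<subseteq> UNIV \<times> {..<N * s}" "s > 0" and "k > 0"
    and avoid: "\<not> contains_double k \<sigma> A" and \<sigma>: "\<And>j. j < k \<Longrightarrow> \<sigma> j < k"
  shows "card {b \<in> contract s A ` A. \<exists>r. 2 * k < card {c. (r, c) \<in> chunk s A b}}
           \<le> N * 2 ^ s * k"
proof -
  define W where "W = {b \<in> contract s A ` A. \<exists>r. 2 * k < card {c. (r, c) \<in> chunk s A b}}"
  \<comment> \<open>More than \<open>2 * k\<close> entries leave at least \<open>2 * k\<close> in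
    one block after the stray entry is dropped.\<close>
  have "\<exists>r t L. 2 * k \<le> card L \<and> L \<subseteq> {t * s..<t * s + s} \<and> (\<forall>c\<in>L. (r, c) \<in> chunk s A b)"
    if b: "b \<in> W" for b
  proof -
    obtain r where r: "2 * k < card {c. (r, c) \<in> chunk s A b}"
      using b by (auto simp: W_def)
    obtain t where "card {c. (r, c) \<in> chunk s A b} \<le>
        Suc (card ({c. (r, c) \<in> chunk s A b} \<inter> {t * s..<t * s + s}))"
      using chunk_row_last_block[OF A(1,3)] by blast
    with r have "2 * k \<le> card ({c. (r, c) \<in> chunk s A b} \<inter> {t * s..<t * s + s})"
      by simp
    then show ?thesis
      by blast
  qed
  then obtain r t L where rtL: "\<And>b. b \<in> W \<Longrightarrow> 2 * k \<le> card (L b) \<and>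
      L b \<subseteq> {t b * s..<t b * s + s} \<and> (\<forall>c\<in>L b. (r b, c) \<in> chunk s A b)"
    by metis
  then have L: "\<And>b. b \<in> W \<Longrightarrow> 2 * k \<le> card (L b)"
    and L_block: "\<And>b. b \<in> W \<Longrightarrow> L b \<subseteq> {t b * s..<t b * s + s}"
    and L_chunk: "\<And>b c. b \<in> W \<Longrightarrow> c \<in> L b \<Longrightarrow> (r b, c) \<in> chunk s A b"
    by blast+
  have ne: "L b \<noteq> {}" if "b \<in> W" for b
    using L[OF that] \<open>k > 0\<close> by auto
  \<comment> \<open>A chunk is determined by its block row and any one of its blocks, so distinct
    chunks sharing the block \<open>t b\<close> lie in distinct block rows.\<close>
  have b_eq: "b = (r b div s, chunk_start s A (r b div s) (t b))" if b: "b \<in> W" for b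
  proof -
    obtain c where c: "c \<in> L b"
      using ne[OF b] by blast
    then have "c div s = t b"
      using L_block[OF b] in_block_iff[OF A(3)] by blast
    then show ?thesis
      using L_chunk[OF b c] by (auto simp: chunk_def contract_def)
  qed
  show ?thesis
    unfolding W_def[symmetric]
  proof (rule card_blocks_le[where f = "\<lambda>b. (t b, L b)"])
    fix t0 L0
    define X where "X = {b \<in> W. (t b, L b) = (t0, L0)}"
    have finX: "finite X"
      using A(1) by (simp add: X_def W_def)
    show "card {b \<in> W. (t b, L b) = (t0, L0)} \<le> k"
    proof (rule ccontr)
      assume "\<not> ?thesis"
      then have big: "k < card X"
        by (simp add: X_def)
      have XW: "b \<in> W" "t b = t0" "L b = L0" if "b \<in> X" for b
        using that unfolding X_def by auto
      have "inj_on (\<lambda>b. r b div s) X"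
      proof (rule inj_onI)
        fix b b' assume b: "b \<in> X" "b' \<in> X" "r b div s = r b' div s"
        have "b = (r b div s, chunk_start s A (r b div s) t0)"
          using b_eq[of b] XW[OF b(1)] by simp
        also have "\<dots> = b'"
          using b_eq[of b'] XW[OF b(2)] b(3) by simp
        finally show "b = b'" .
      qed
      then have "k \<le> card ((\<lambda>b. r b div s) ` X)"
        using big by (simp add: card_image)
      then obtain q where q: "\<And>i. i < k \<Longrightarrow> q i \<in> (\<lambda>b. r b div s) ` X"
        "\<And>i j. i < j \<Longrightarrow> j < k \<Longrightarrow> q i < q j"
        using increasing_enumeration[of k "(\<lambda>b. r b div s) ` X"] finX by blast
      define \<beta> where "\<beta> i = inv_into X (\<lambda>b. r b div s) (q i)" for i
      have \<beta>: "\<beta> i \<in> X \<and> r (\<beta> i) div s = q i" if "i < k" for i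
        unfolding \<beta>_def using inv_into_into[OF q(1)[OF that]] f_inv_into_f[OF q(1)[OF that]] by simp
      have "\<beta> 0 \<in> X"
        using \<beta> \<open>k > 0\<close> by blast
      then have "2 * k \<le> card L0" "finite L0"
        using L[of "\<beta> 0"] L_block[of "\<beta> 0"] XW[of "\<beta> 0"] finite_subset by auto
      then obtain e where e: "\<And>i. i < 2 * k \<Longrightarrow> e i \<in> L0"
        "\<And>i j. i < j \<Longrightarrow> j < 2 * k \<Longrightarrow> e i < e j"
        using increasing_enumeration by blast
      have inA: "(r (\<beta> j), e i) \<in> A" if "j < k" "i < 2 * k" for i j
      proof -
        have "\<beta> j \<in> X"
          using \<beta> that by blast
        then have "(r (\<beta> j), e i) \<in> chunk s A (\<beta> j)"
          using L_chunk XW e(1)[OF that(2)] by blast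
        then show ?thesis
          by (simp add: chunk_def)
      qed
      have "contains_double k \<sigma> A"
        unfolding contains_double_def
      proof (intro exI conjI allI impI)
        fix j j' assume "j < j'" "j' < k"
        then show "r (\<beta> j) < r (\<beta> j')"
          using q(2) \<beta> div_le_mono[of "r (\<beta> j')" "r (\<beta> j)" s]
          by (metis leD le_less_linear less_trans)
      next
        fix j assume j: "j < k"
        show "(r (\<beta> j), e (2 * \<sigma> j)) \<in> A" "(r (\<beta> j), e (2 * \<sigma> j + 1)) \<in> A"
          "e (2 * \<sigma> j) < e (2 * \<sigma> j + 1)"
          using j \<sigma>[OF j] by (auto intro: inA e(2))
        fix j' assume j': "j' < k" "\<sigma> j < \<sigma> j'"
        show "e (2 * \<sigma> j + 1) < e (2 * \<sigma> j')"
          using j j' \<sigma>[OF j'(1)] by (intro e(2)) auto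
      qed
      then show False
        using avoid by simp
    qed
  next
    fix b assume b: "b \<in> W"
    obtain c where c: "c \<in> L b"
      using ne[OF b] by blast
    then have "c < N * s" "t b * s \<le> c"
      using L_chunk[OF b c] L_block[OF b] A(2) by (auto simp: chunk_def)
    then have "t b < N"
      by (metis le_less_trans mult_less_cancel2)
    then show "(t b, L b) \<in> (SIGMA q:{..<N}. Pow {q * s..<q * s + s})"
      using L_block[OF b] by simp
  qed (use A in \<open>auto simp: W_def\<close>)
qed

section \<open>The recursion and its linear solution\<close>

text \<open>The first summand charges \<open>s * (s + 1)\<close> entries to each of the at most
  \<open>N * 2 ^ s * (3 * k)\<close> tall or wide chunks, the second \<open>2 * k\<^sup>2\<close>
  entries to every other chunk.\<close>

lemma card_le_contract:
  assumes A: "A \<subseteq> {..<N * s} \<times> {..<N * s}" "s > 0" and "k > 0"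
    and avoid: "\<not> contains_double k \<sigma> A" and \<sigma>: "\<And>j. j < k \<Longrightarrow> \<sigma> j < k"
  shows "contract s A ` A \<subseteq> {..<N} \<times> {..<N}"
    and "card A \<le> N * (2 ^ s * (3 * k) * (s * (s + 1))) + card (contract s A ` A) * (2 * k\<^sup>2)"
proof -
  have fin: "finite A"
    using A(1) finite_subset by blast
  show sub: "contract s A ` A \<subseteq> {..<N} \<times> {..<N}"
  proof
    fix b assume "b \<in> contract s A ` A"
    then obtain r c where rc: "(r, c) \<in> A" and b: "b = contract s A (r, c)"
      by auto
    have "r div s < N" "c div s < N"
      using A rc by (auto simp: div_less_iff_less_mult)
    then show "b \<in> {..<N} \<times> {..<N}"
      using chunk_start_le[of s A "r div s" "c div s"] by (simp add: b contract_Pair)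
  qed
  define B where "B = contract s A ` A"
  define T where "T = {b \<in> B. k \<le> card (fst ` chunk s A b)}"
  define W where "W = {b \<in> B. \<exists>r. 2 * k < card {c. (r, c) \<in> chunk s A b}}"
  have finB: "finite B"
    using fin by (simp add: B_def)
  have T: "card T \<le> N * 2 ^ s * (2 * k)"
    unfolding T_def B_def using card_tall_chunks[OF fin sub A(2) avoid \<sigma>] .
  have W: "card W \<le> N * 2 ^ s * k"
    unfolding W_def B_def using A(1) by (intro card_wide_chunks[OF fin _ A(2) \<open>k > 0\<close> avoid \<sigma>]) auto
  have rows: "card (fst ` chunk s A b) \<le> s" for b
    using card_mono[OF _ chunk_rows_subset[OF A(2)]] by fastforce
  \<comment> \<open>There are at most \<open>s\<close> rows, each with at most \<open>s\<close>
    entries in a single block and one stray entry.\<close>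
  have any: "card (chunk s A b) \<le> s * (s + 1)" for b
  proof -
    have "card {c. (r, c) \<in> chunk s A b} \<le> s + 1" for r
    proof -
      obtain t where t: "card {c. (r, c) \<in> chunk s A b} \<le>
          Suc (card ({c. (r, c) \<in> chunk s A b} \<inter> {t * s..<t * s + s}))"
        using chunk_row_last_block[OF fin A(2)] by blast
      have "card ({c. (r, c) \<in> chunk s A b} \<inter> {t * s..<t * s + s}) \<le> card {t * s..<t * s + s}"
        by (intro card_mono) auto
      with t show ?thesis
        by simp
    qed
    then show ?thesis
      using card_chunk_le[OF fin] rows[of b] by (meson le_trans mult_le_mono1)
  qed
  have small: "card (chunk s A b) \<le> 2 * k\<^sup>2" if "b \<in> B - (T \<union> W)" for b
  proof -
    have "card (fst ` chunk s A b) \<le> k" "\<And>r. card {c. (r, c) \<in> chunk s A b} \<le> 2 * k"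
      using that by (auto simp: T_def W_def not_less not_le)
    then have "card (chunk s A b) \<le> k * (2 * k)"
      using card_chunk_le[OF fin] by (meson le_trans mult_le_mono1)
    then show ?thesis
      by (simp add: power2_eq_square mult.left_commute)
  qed
  have "card {x\<in>A. contract s A x \<in> T \<union> W} \<le> card (T \<union> W) * (s * (s + 1))"
  proof (rule card_le_fibres[where f = "contract s A"])
    fix b assume "b \<in> T \<union> W"
    then have "{x \<in> {x\<in>A. contract s A x \<in> T \<union> W}. contract s A x = b} = chunk s A b"
      by (auto simp: chunk_def)
    then show "card {x \<in> {x\<in>A. contract s A x \<in> T \<union> W}. contract s A x = b} \<le> s * (s + 1)"
      using any by simp
  qed (use fin finB in \<open>auto simp: T_def W_def\<close>)
  also have "\<dots> \<le> N * 2 ^ s * (3 * k) * (s * (s + 1))"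
    using card_Un_le[of T W] T W by (intro mult_le_mono1) (simp add: algebra_simps)
  finally have 1: "card {x\<in>A. contract s A x \<in> T \<union> W} \<le> N * 2 ^ s * (3 * k) * (s * (s + 1))" .
  have "card {x\<in>A. contract s A x \<notin> T \<union> W} \<le> card (B - (T \<union> W)) * (2 * k\<^sup>2)"
  proof (rule card_le_fibres[where f = "contract s A"])
    fix b assume b: "b \<in> B - (T \<union> W)"
    then have "{x \<in> {x\<in>A. contract s A x \<notin> T \<union> W}. contract s A x = b} = chunk s A b"
      by (auto simp: chunk_def)
    then show "card {x \<in> {x\<in>A. contract s A x \<notin> T \<union> W}. contract s A x = b} \<le> 2 * k\<^sup>2"
      using small[OF b] by simp
  qed (use fin finB in \<open>auto simp: B_def\<close>)
  also have "\<dots> \<le> card B * (2 * k\<^sup>2)"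
    using finB by (intro mult_le_mono1 card_mono) auto
  finally have 2: "card {x\<in>A. contract s A x \<notin> T \<union> W} \<le> card B * (2 * k\<^sup>2)" .
  have "card A = card ({x\<in>A. contract s A x \<in> T \<union> W} \<union> {x\<in>A. contract s A x \<notin> T \<union> W})"
    by (rule arg_cong[where f = card]) blast
  then have "card A \<le> card {x\<in>A. contract s A x \<in> T \<union> W} + card {x\<in>A. contract s A x \<notin> T \<union> W}"
    using card_Un_le by (rule ord_eq_le_trans)
  with 1 2 show "card A \<le> N * (2 ^ s * (3 * k) * (s * (s + 1))) +
      card (contract s A ` A) * (2 * k\<^sup>2)"
    unfolding B_def by (simp only: mult.assoc)
qed

theorem avoids_double_linear:
  assumes "k > 0" and \<sigma>: "\<And>j. j < k \<Longrightarrow> \<sigma> j < k"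
  shows "\<exists>C. \<forall>n A. A \<subseteq> {..<n} \<times> {..<n} \<longrightarrow> \<not> contains_double k \<sigma> A \<longrightarrow> card A \<le> C * n"
proof -
  \<comment> \<open>As \<open>N * s \<le> 2 * n\<close>, the recursive term
    \<open>C * N * (2 * k\<^sup>2)\<close> is then at most half of \<open>C * n\<close>, which
    leaves room for the term \<open>N * K\<close>.\<close>
  define s where "s = 8 * k\<^sup>2"
  define K where "K = 2 ^ s * (3 * k) * (s * (s + 1))"
  \<comment> \<open>The summand \<open>s\<close> covers the base case \<open>n < s\<close>, where
    the trivial bound \<open>n * n\<close> suffices.\<close>
  define C where "C = K + s"
  have k2: "k\<^sup>2 \<ge> 1"
    using assms(1) by simp
  then have s: "s \<ge> 8"
    unfolding s_def by linarith
  have "card A \<le> C * n" if "A \<subseteq> {..<n} \<times> {..<n}" "\<not> contains_double k \<sigma> A" for n A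
    using that
  proof (induction n arbitrary: A rule: less_induct)
    case (less n)
    show ?case
    proof (cases "n < s")
      case True
      have "card A \<le> n * n"
        using card_mono[OF _ less.prems(1)] by simp
      also have "\<dots> \<le> C * n"
        using True by (simp add: C_def)
      finally show ?thesis .
    next
      case False
      define N where "N = n div s + 1"
      have "N * s = n div s * s + s"
        by (simp add: N_def)
      then have Ns: "n \<le> N * s" "N * s \<le> 2 * n"
        using False s dividend_less_div_times[of s n] div_times_less_eq_dividend[of n s]
        by linarith+
      have "N * 8 \<le> 2 * n"
        using Ns(2) s by (meson le_trans mult_le_mono2)
      then have "N < n"
        using False s by linarith
      have sub: "A \<subseteq> {..<N * s} \<times> {..<N * s}"
        using less.prems(1) Ns(1) by fastforce
      have s0: "s > 0"
        using s by simp
      note contr = card_le_contract[OF sub s0 assms(1) less.prems(2) \<sigma>]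
      have "card (contract s A ` A) \<le> C * N"
        using less.IH[OF \<open>N < n\<close> contr(1)] less.prems(2) contains_double_contract by blast
      then have "card A \<le> N * K + C * N * (2 * k\<^sup>2)"
        using contr(2) by (fold K_def) (meson add_left_mono le_trans mult_le_mono1)
      \<comment> \<open>Multiplying by \<open>s\<close> avoids division of natural numbers.\<close>
      then have "s * card A \<le> s * (N * K + C * N * (2 * k\<^sup>2))"
        by (rule mult_le_mono2)
      also have "\<dots> = (N * s) * (K + 2 * k\<^sup>2 * C)"
        by (simp add: algebra_simps)
      also have "\<dots> \<le> (2 * n) * (K + 2 * k\<^sup>2 * C)"
        using Ns(2) by (rule mult_le_mono1)
      also have "\<dots> \<le> (2 * n) * (4 * k\<^sup>2 * C)"
      proof (rule mult_le_mono2)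
        have "K \<le> 1 * C"
          by (simp add: C_def)
        also have "\<dots> \<le> 2 * k\<^sup>2 * C"
          using k2 by (intro mult_le_mono1) linarith
        finally show "K + 2 * k\<^sup>2 * C \<le> 4 * k\<^sup>2 * C"
          by linarith
      qed
      also have "\<dots> = s * (C * n)"
        by (simp add: s_def)
      finally show ?thesis
        using s by simp
    qed
  qed
  then show ?thesis
    by blast
qed

section \<open>From ordered graphs to matrices\<close>

text \<open>The first \<open>k\<close> vertices go to the rows, and the \<open>p\<close>-th pair of
  the remaining ones goes to the two columns of the row that \<open>\<pi>\<close> sends to
  \<open>p\<close>. Rows are numbered from 0 here, hence \<open>Suc\<close> in the argument of
  \<open>\<pi>\<close>.\<close>

lemma contains_two_tuple_matching:
  fixes G :: "nat ograph"
  assumes \<pi>: "bij_betw \<pi> {1..k} {1..k}"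
    and verts: "\<And>j. j < k \<Longrightarrow> r j \<in> verts G \<and> a j \<in> verts G \<and> b j \<in> verts G"
    and edges: "\<And>j. j < k \<Longrightarrow> {r j, a j} \<in> edges G \<and> {r j, b j} \<in> edges G"
    and r: "\<And>j j'. j < j' \<Longrightarrow> j' < k \<Longrightarrow> r j < r j'"
    and ra: "\<And>j j'. j < k \<Longrightarrow> j' < k \<Longrightarrow> r j < a j'"
    and ab: "\<And>j. j < k \<Longrightarrow> a j < b j"
    and ba: "\<And>j j'. j < k \<Longrightarrow> j' < k \<Longrightarrow> \<pi> (Suc j) < \<pi> (Suc j') \<Longrightarrow> b j < a j'"
  shows "og_contains G (two_tuple_matching k \<pi>)"
proof -
  define \<tau> where "\<tau> p = inv_into {1..k} \<pi> p - 1" for p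
  have \<tau>: "\<tau> p < k" "\<pi> (Suc (\<tau> p)) = p" if "p \<in> {1..k}" for p
  proof -
    have "inv_into {1..k} \<pi> p \<in> {1..k}" "\<pi> (inv_into {1..k} \<pi> p) = p"
      using that \<pi> by (auto simp: bij_betw_def inv_into_into f_inv_into_f simp del: atLeastAtMost_iff)
    then show "\<tau> p < k" "\<pi> (Suc (\<tau> p)) = p"
      by (auto simp: \<tau>_def)
  qed
  have \<tau>\<pi>: "\<tau> (\<pi> j) = j - 1" "\<pi> j \<in> {1..k}" if "j \<in> {1..k}" for j
    using that \<pi> by (auto simp: \<tau>_def bij_betw_def simp del: atLeastAtMost_iff)
  \<comment> \<open>For \<open>v > k\<close>, the number \<open>v - k - 1\<close> is the column
    counted from 0. Its half plus one is the number of the pair, and its parity selects the left or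
    right column.\<close>
  define f where "f v = (if v \<le> k then r (v - 1)
    else if even (v - k - 1) then a (\<tau> ((v - k - 1) div 2 + 1))
    else b (\<tau> ((v - k - 1) div 2 + 1)))" for v
  have p: "(v - k - 1) div 2 + 1 \<in> {1..k}" if "v \<in> {1..3 * k}" "\<not> v \<le> k" for v
    using that by auto
  \<comment> \<open>Strict monotonicity gives both injectivity and preservation of the
    order.\<close>
  have less: "f v < f w" if vw: "v \<in> {1..3 * k}" "w \<in> {1..3 * k}" "v < w" for v w
  proof -
    consider (rows) "w \<le> k" | (mixed) "v \<le> k" "\<not> w \<le> k" | (cols) "\<not> v \<le> k" "\<not> w \<le> k"
      by linarith
    then show ?thesis
    proof cases
      case rows
      then show ?thesis
        using vw by (auto simp: f_def intro!: r)
    next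
      case mixed
      let ?j = "\<tau> ((w - k - 1) div 2 + 1)"
      have "r (v - 1) < a ?j" "a ?j < b ?j"
        using \<tau>(1)[OF p[OF vw(2) mixed(2)]] mixed vw by (auto intro!: ra ab)
      then show ?thesis
        using mixed by (auto simp: f_def)
    next
      case cols
      define x y where "x = v - k - 1" and "y = w - k - 1"
      have "x < y"
        using vw cols by (auto simp: x_def y_def)
      have px: "x div 2 + 1 \<in> {1..k}" and py: "y div 2 + 1 \<in> {1..k}"
        using p vw cols unfolding x_def y_def by blast+
      have fv: "f v = (if even x then a (\<tau> (x div 2 + 1)) else b (\<tau> (x div 2 + 1)))"
        and fw: "f w = (if even y then a (\<tau> (y div 2 + 1)) else b (\<tau> (y div 2 + 1)))"
        using cols by (auto simp: f_def x_def y_def)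
      note abx = ab[OF \<tau>(1)[OF px]] and aby = ab[OF \<tau>(1)[OF py]]
      show ?thesis
      proof (cases "x div 2 = y div 2")
        case True
        then have "even x" "odd y"
          using \<open>x < y\<close> by presburger+
        then show ?thesis
          using fv fw abx True by simp
      next
        case False
        then have "x div 2 < y div 2"
          using \<open>x < y\<close> by (simp add: div_le_mono le_neq_implies_less)
        then have "b (\<tau> (x div 2 + 1)) < a (\<tau> (y div 2 + 1))"
          using \<tau>[OF px] \<tau>[OF py] by (intro ba) auto
        then show ?thesis
          using fv fw abx aby by auto
      qed
    qed
  qed
  show ?thesis
    unfolding og_contains_def
  proof (intro exI[of _ f] conjI ballI)
    have V: "verts (two_tuple_matching k \<pi>) = {1..3 * k}"
      by (simp add: two_tuple_matching_def)
    show "inj_on f (verts (two_tuple_matching k \<pi>))"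
      unfolding V by (metis inj_onI less less_irrefl nat_neq_iff)
    show "mono_on (verts (two_tuple_matching k \<pi>)) f"
      unfolding V by (metis mono_onI less le_less)
    show "f ` verts (two_tuple_matching k \<pi>) \<subseteq> verts G"
    proof
      fix x assume "x \<in> f ` verts (two_tuple_matching k \<pi>)"
      then obtain v where v: "v \<in> {1..3 * k}" "x = f v"
        unfolding V by blast
      show "x \<in> verts G"
      proof (cases "v \<le> k")
        case True
        then show ?thesis
          using v verts[of "v - 1"] by (auto simp: f_def)
      next
        case False
        then show ?thesis
          using v verts[OF \<tau>(1)[OF p[OF v(1) False]]] by (auto simp: f_def)
      qed
    qed
    fix e assume "e \<in> edges (two_tuple_matching k \<pi>)"
    then obtain i j where ij: "i \<in> {1, 2}" "j \<in> {1..k}" and e: "e = {j, k + i + 2 * (\<pi> j - 1)}"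
      by (auto simp: two_tuple_matching_def)
    have "j - 1 < k" and \<pi>j: "\<pi> j - 1 + 1 = \<pi> j"
      using ij(2) \<tau>\<pi>(2)[OF ij(2)] by auto
    have "f j = r (j - 1)"
      using ij by (simp add: f_def)
    moreover have "f (k + i + 2 * (\<pi> j - 1)) = (if i = 1 then a (j - 1) else b (j - 1))"
    proof -
      have "(k + i + 2 * (\<pi> j - 1) - k - 1) div 2 + 1 = \<pi> j"
        "even (k + i + 2 * (\<pi> j - 1) - k - 1) \<longleftrightarrow> i = 1" "\<not> k + i + 2 * (\<pi> j - 1) \<le> k"
        using ij(1) \<pi>j by auto
      then show ?thesis
        unfolding f_def using \<tau>\<pi>(1)[OF ij(2)] by (simp only: if_False)
    qed
    ultimately show "f ` e \<in> edges G"
      using edges[OF \<open>j - 1 < k\<close>] by (simp add: e)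
  qed
qed

lemma card_edges_linear:
  assumes "bij_betw \<pi> {1..k} {1..k}"
  shows "\<exists>C. \<forall>G :: nat ograph. ordered_graph G \<longrightarrow> og_avoids G (two_tuple_matching k \<pi>) \<longrightarrow>
           card (edges G) \<le> C * card (verts G)"
proof -
  \<comment> \<open>The additional row \<open>k\<close> is assigned the first pair of columns.\<close>
  define \<sigma> where "\<sigma> j = (if j < k then \<pi> (Suc j) else 0)" for j
  have \<pi>: "\<pi> (Suc j) \<in> {1..k}" if "j < k" for j
    using bij_betwE[OF assms] that by auto
  have "\<sigma> j < Suc k" if "j < Suc k" for j
    using \<pi>[of j] by (auto simp: \<sigma>_def)
  then obtain C where C: "\<And>n A. A \<subseteq> {..<n} \<times> {..<n} \<Longrightarrow> \<not> contains_double (Suc k) \<sigma> A \<Longrightarrow>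
      card A \<le> C * n"
    using avoids_double_linear[of "Suc k" \<sigma>] by blast
  have "card (edges G) \<le> C * card (verts G)"
    if G: "ordered_graph G" and avoid: "og_avoids G (two_tuple_matching k \<pi>)" for G :: "nat ograph"
  proof -
    define n where "n = card (verts G)"
    define e where "e = (\<lambda>i. sorted_list_of_set (verts G) ! i)"
    have fin: "finite (verts G)"
      using G by (simp add: ordered_graph_def)
    have e_mono: "e i < e j" if "i < j" "j < n" for i j
      using that strict_sorted_list_of_set[of "verts G"] fin
      by (simp add: sorted_wrt_iff_nth_less e_def n_def)
    have e_img: "e ` {..<n} = verts G"
      using fin nth_image[of n "sorted_list_of_set (verts G)"]
      by (simp add: e_def n_def lessThan_atLeast0)
    \<comment> \<open>Vertices are replaced by their ranks, and each edge is recorded once, with the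
      smaller end as its row.\<close>
    define A where "A = {(i, j). i < j \<and> j < n \<and> {e i, e j} \<in> edges G}"
    have sub: "A \<subseteq> {..<n} \<times> {..<n}"
      by (auto simp: A_def)
    have "edges G \<subseteq> (\<lambda>(i, j). {e i, e j}) ` A"
    proof
      fix d assume d: "d \<in> edges G"
      then have "d \<subseteq> verts G" "card d = 2"
        using G by (auto simp: ordered_graph_def)
      then obtain x y where xy: "d = {x, y}" "x \<noteq> y" "x \<in> verts G" "y \<in> verts G"
        by (auto simp: card_2_iff)
      then obtain i j where ij: "x = e i" "y = e j" "i < n" "j < n"
        using e_img by (metis imageE lessThan_iff)
      with xy have "i \<noteq> j"
        by auto
      then have "(i, j) \<in> A \<or> (j, i) \<in> A"
        using d xy ij by (auto simp: A_def insert_commute)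
      then show "d \<in> (\<lambda>(i, j). {e i, e j}) ` A"
        using xy ij by (force simp: insert_commute)
    qed
    then have "card (edges G) \<le> card A"
      using sub by (meson finite_SigmaI finite_lessThan finite_subset surj_card_le)
    moreover have "\<not> contains_double (Suc k) \<sigma> A"
    proof
      assume "contains_double (Suc k) \<sigma> A"
      then obtain r a b where
        mem: "\<And>j. j < Suc k \<Longrightarrow> (r j, a j) \<in> A \<and> (r j, b j) \<in> A \<and> a j < b j"
        and r: "\<And>j j'. j < j' \<Longrightarrow> j' < Suc k \<Longrightarrow> r j < r j'"
        and ba: "\<And>j j'. j < Suc k \<Longrightarrow> j' < Suc k \<Longrightarrow> \<sigma> j < \<sigma> j' \<Longrightarrow> b j < a j'"
        using contains_doubleE by metis
      have n: "r j < n" "a j < n" "b j < n" if "j < k" for j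
        using mem[of j] that by (auto simp: A_def)
      have "og_contains G (two_tuple_matching k \<pi>)"
      proof (rule contains_two_tuple_matching[OF assms, of "\<lambda>j. e (r j)" G "\<lambda>j. e (a j)" "\<lambda>j. e (b j)"])
        fix j assume j: "j < k"
        show "e (r j) \<in> verts G \<and> e (a j) \<in> verts G \<and> e (b j) \<in> verts G"
          using n[OF j] e_img by blast
        show "{e (r j), e (a j)} \<in> edges G \<and> {e (r j), e (b j)} \<in> edges G"
          using mem[of j] j by (auto simp: A_def)
        show "e (a j) < e (b j)"
          using mem[of j] n[OF j] j by (auto intro: e_mono)
        fix j' assume j': "j' < k"
        \<comment> \<open>The extra row \<open>k\<close> separates rows from columns: it is the last
          row, its entries lie above the diagonal, and \<open>\<sigma> k = 0\<close> puts its
          columns before all others.\<close>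
        have "r j < r k" "r k < a k" "a k < b k" "b k < a j'"
          using r[of j k] mem[of k] ba[of k j'] j j' \<pi>[OF j'] by (auto simp: A_def \<sigma>_def)
        then show "e (r j) < e (a j')"
          using n[OF j'] by (intro e_mono) auto
        show "e (b j) < e (a j')" if "\<pi> (Suc j) < \<pi> (Suc j')"
          using ba[of j j'] that j j' n[OF j'] by (intro e_mono) (auto simp: \<sigma>_def)
      next
        fix j j' assume "j < j'" "j' < k"
        then show "e (r j) < e (r j')"
          using r[of j j'] n[of j'] by (intro e_mono) auto
      qed
      then show False
        using avoid by simp
    qed
    ultimately show ?thesis
      using C[OF sub] by (simp add: n_def)
  qed
  then show ?thesis
    by blast
qed

theorem theorem3p1:
  fixes k :: nat and \<pi> :: "nat \<Rightarrow> nat"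
  assumes "k \<ge> 1"
    and "bij_betw \<pi> {1..k} {1..k}"
  shows "(\<lambda>n. real (ex_ord n (two_tuple_matching k \<pi>))) \<in> O(\<lambda>n. real n)"
proof -
  let ?P = "two_tuple_matching k \<pi>"
  obtain C where C: "\<And>G :: nat ograph. ordered_graph G \<Longrightarrow> og_avoids G ?P \<Longrightarrow>
      card (edges G) \<le> C * card (verts G)"
    using card_edges_linear[OF assms(2)] by blast
  \<comment> \<open>Since \<open>k \<ge> 1\<close> the pattern has an edge, so the maximum is over a
    finite nonempty set and can be bounded elementwise.\<close>
  note wd = ex_ord_welldefined[OF edges_two_tuple_matching_nonempty[OF assms(1), of \<pi>]]
  have "ex_ord n ?P \<le> C * n" for n
    unfolding ex_ord_def Max_le_iff[OF wd] using C by blast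
  then have "real (ex_ord n ?P) \<le> real C * real n" for n
    by (metis of_nat_le_iff of_nat_mult)
  then show ?thesis
    by (intro bigoI[of _ "real C"]) auto
qed

end
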